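(* Let $d\ge 1$ and $n$ be such that $2^d+d=n/2$. Then every deterministic OBDD (with any variable order) computing $\mathtt{SSA}_n$ has width at least $2^{2^d}$, i.e. $\mathsf{OBDD}(\mathtt{SSA}_n)\ge 2^{2^d}$.
   Context: Shuffled Storage Access function $\mathtt{SSA}_n:\{0,1\}^n\to\{0,1\}$ ($n$ even, $2^d+d=n/2$): for input $x$, let $I_0=(2i_1<\dots<2i_m)$ be the sorted list of even indices $2i$ with $x_{2i-1}=0$ and $I_1=(2j_1<\dots<2j_k)$ the sorted list of even indices $2i$ with $x_{2i-1}=1$. Let $\mathtt{ShiftX}((a_1,\dots,a_t),b)=(a_2,\dots,a_t,a_1\oplus b)$. Start with $\alpha=0^{2^d}$ and for $r=1,\dots,m$ set $\alpha:=\mathtt{ShiftX}(\alpha,x_{2i_r})$; start with $\beta=0^d$ and for $r=1,\dots,k$ set $\beta:=\mathtt{ShiftX}(\beta,x_{2j_r})$. Then $\mathtt{SSA}_n(x)=\mathtt{SA}_d(\alpha,\beta)$, where the storage access function $\mathtt{SA}_d(\alpha,\beta)$ returns the bit of the storage $\alpha\in\{0,1\}^{2^d}$ at the address encoded in binary by $\beta\in\{0,1\}^d$. A deterministic OBDD of width $m$ over $x_1,\dots,x_n$ consists of a permutation $\pi$ of $\{1,\dots,n\}$, a set $S$ of $m$ states, an initial state, maps $T_j^0,T_j^1:S\to S$ for each step $j$, and an accepting set; on input $x$ it applies $T_j^{x_{\pi(j)}}$ at step $j$ starting from the initial state and outputs $1$ iff the final state is accepting. $\mathsf{OBDD}(f)$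 is the minimum width over all such OBDDs computing $f$. *)

theory Defs
  imports Main "HOL-Library.FuncSet" "HOL-Combinatorics.Permutations"
begin

text \<open>
  An input of length \<open>n\<close> is a function \<open>x\<close> with \<open>x i\<close> the value of the variable \<open>x\<^sub>i\<close>
  (1-based), \<open>undefined\<close> outside of \<open>{1..n}\<close>. The bits 0 and 1 are \<^const>\<open>False\<close> and \<^const>\<open>True\<close>,
  so that exclusive or is \<open>\<noteq>\<close>.
\<close>

definition inputs :: "nat \<Rightarrow> (nat \<Rightarrow> bool) set" where
  "inputs n = {1..n} \<rightarrow>\<^sub>E UNIV"

fun ShiftX :: "bool list \<Rightarrow> bool \<Rightarrow> bool list" where
  "ShiftX [] b = []"
| "ShiftX (a # as) b = as @ [a \<noteq> b]"

text \<open>Addresses are read with the most significant bit first; address 0 is the first bit of the storage.\<close>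

definition SA :: "bool list \<Rightarrow> bool list \<Rightarrow> bool" where
  "SA \<alpha> \<beta> = \<alpha> ! horner_sum of_bool 2 (rev \<beta>)"

definition marked_indices :: "nat \<Rightarrow> (nat \<Rightarrow> bool) \<Rightarrow> bool \<Rightarrow> nat list" where
  "marked_indices n x b = sorted_list_of_set {2 * i | i. i \<in> {1..n div 2} \<and> x (2 * i - 1) = b}"

definition shift_all :: "(nat \<Rightarrow> bool) \<Rightarrow> bool list \<Rightarrow> nat list \<Rightarrow> bool list" where
  "shift_all x \<alpha> ks = foldl (\<lambda>\<alpha> k. ShiftX \<alpha> (x k)) \<alpha> ks"

text \<open>Meaningful for even \<open>n\<close> with \<open>2 ^ d + d = n div 2\<close>, where \<open>n\<close> and \<open>d\<close> determine each other.\<close>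

definition SSA :: "nat \<Rightarrow> nat \<Rightarrow> (nat \<Rightarrow> bool) \<Rightarrow> bool" where
  "SSA d n x =
     SA (shift_all x (replicate (2 ^ d) False) (marked_indices n x False))
        (shift_all x (replicate d False) (marked_indices n x True))"

record 's obdd =
  var_order :: "nat \<Rightarrow> nat"
  states :: "'s set"
  init :: 's
  trans_map :: "nat \<Rightarrow> bool \<Rightarrow> 's \<Rightarrow> 's"
  accepting :: "'s set"

definition is_obdd :: "nat \<Rightarrow> 's obdd \<Rightarrow> bool" where
  "is_obdd n B \<longleftrightarrow>
     var_order B permutes {1..n} \<and>
     finite (states B) \<and>
     init B \<in> states B \<and>
     (\<forall>j\<in>{1..n}. \<forall>b. trans_map B j b \<in> states B \<rightarrow> states B) \<and>
     accepting B \<subseteq> states B"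

definition width :: "'s obdd \<Rightarrow> nat" where
  "width B = card (states B)"

fun state_after :: "'s obdd \<Rightarrow> (nat \<Rightarrow> bool) \<Rightarrow> nat \<Rightarrow> 's" where
  "state_after B x 0 = init B"
| "state_after B x (Suc j) = trans_map B (Suc j) (x (var_order B (Suc j))) (state_after B x j)"

definition computes :: "nat \<Rightarrow> 's obdd \<Rightarrow> ((nat \<Rightarrow> bool) \<Rightarrow> bool) \<Rightarrow> bool" where
  "computes n B f \<longleftrightarrow> (\<forall>x\<in>inputs n. state_after B x n \<in> accepting B \<longleftrightarrow> f x)"

text \<open>
  States range over natural numbers, which loses no generality since state sets are finite.
  As \<open>Inf {} = 0\<close> on \<^typ>\<open>nat\<close>, a positive lower bound entails that some OBDD computes \<open>f\<close>.
\<close>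

definition OBDD :: "nat \<Rightarrow> ((nat \<Rightarrow> bool) \<Rightarrow> bool) \<Rightarrow> nat" where
  "OBDD n f = Inf {width B | B :: nat obdd. is_obdd n B \<and> computes n B f}"

end

theory Submission
  imports Defs "HOL-Library.Nat_Bijection"
begin

text \<open>
  An OBDD has at least as many states as there are subfunctions obtained by fixing the first \<open>j\<close>
  variables of its order. Choose \<open>j\<close> such that exactly \<open>2 ^ d\<close> of these variables have an even
  index. Fix the odd-indexed variables so that these even-indexed ones are shifted into the storage
  and the \<open>d\<close> remaining ones into the address. A storage of length \<open>2 ^ d\<close> receives exactly \<open>2 ^ d\<close>
  shifts, so it equals the sequence of bits read. Every one of these bits can still be selected by an
  address read later, hence the \<open>2 ^ (2 ^ d)\<close> possible storages yield pairwise different subfunctions.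
\<close>

section \<open>Subfunctions and the width of OBDDs\<close>

lemma finite_inputs: "finite (inputs n)"
  by (simp add: inputs_def finite_PiE)

lemma override_on_in_inputs:
  assumes "x \<in> inputs n" "z \<in> inputs n"
  shows "override_on z x V \<in> inputs n"
  using assms by (auto simp: inputs_def override_on_def PiE_def extensional_def)

text \<open>The subfunction still takes complete inputs, but ignores their values on \<open>V\<close>.\<close>

definition subfunction ::
    "nat \<Rightarrow> ((nat \<Rightarrow> bool) \<Rightarrow> 'a) \<Rightarrow> nat set \<Rightarrow> (nat \<Rightarrow> bool) \<Rightarrow> (nat \<Rightarrow> bool) \<Rightarrow> 'a" where
  "subfunction n f V x = (\<lambda>z\<in>inputs n. f (override_on z x V))"

definition subfunctions ::
    "nat \<Rightarrow> ((nat \<Rightarrow> bool) \<Rightarrow> 'a) \<Rightarrow> nat set \<Rightarrow> ((nat \<Rightarrow> bool) \<Rightarrow> 'a) set" where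
  "subfunctions n f V = subfunction n f V ` inputs n"

lemma finite_subfunctions: "finite (subfunctions n f V)"
  by (simp add: subfunctions_def finite_inputs)

lemma state_after_in_states:
  assumes "is_obdd n B" "j \<le> n"
  shows "state_after B x j \<in> states B"
  using assms(2)
proof (induction j)
  case 0
  then show ?case using assms(1) by (simp add: is_obdd_def)
next
  case (Suc j)
  have "trans_map B (Suc j) b \<in> states B \<rightarrow> states B" for b
    using assms(1) Suc.prems by (simp add: is_obdd_def)
  then show ?case using Suc by auto
qed

lemma state_after_eq_extend:
  assumes "state_after B x j = state_after B y j" "j \<le> k"
    and "\<And>i. i \<in> {j<..k} \<Longrightarrow> x (var_order B i) = y (var_order B i)"
  shows "state_after B x k = state_after B y k"
  using assms(2,3)
proof (induction k rule: dec_induct)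
  case base
  then show ?case using assms(1) by simp
next
  case (step k)
  have "x (var_order B (Suc k)) = y (var_order B (Suc k))"
    using step.hyps(1) by (intro step.prems) auto
  moreover have "state_after B x k = state_after B y k"
    by (rule step.IH) (use step.prems in auto)
  ultimately show ?case by simp
qed

lemma state_after_override_on_eq:
  assumes "inj (var_order B)" "j \<le> k" "state_after B x j = state_after B y j"
  defines "V \<equiv> var_order B ` {1..j}"
  shows "state_after B (override_on z x V) k = state_after B (override_on z y V) k"
proof (rule state_after_eq_extend[OF _ \<open>j \<le> k\<close>])
  have "state_after B (override_on z w V) j = state_after B w j" for w
    by (rule state_after_eq_extend[where j = 0]) (auto simp: V_def)
  then show "state_after B (override_on z x V) j = state_after B (override_on z y V) j"
    using assms(3) by simp
next
  fix i assume "i \<in> {j<..k}"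
  then have "var_order B i \<notin> V"
    by (simp add: V_def inj_image_mem_iff[OF assms(1)])
  then show "override_on z x V (var_order B i) = override_on z y V (var_order B i)"
    by simp
qed

lemma subfunction_eq_if_state_after_eq:
  assumes obdd: "is_obdd n B" "computes n B f" and "j \<le> n"
    and inputs: "x \<in> inputs n" "y \<in> inputs n"
    and state: "state_after B x j = state_after B y j"
  defines "V \<equiv> var_order B ` {1..j}"
  shows "subfunction n f V x = subfunction n f V y"
  unfolding subfunction_def
proof (rule restrict_ext)
  fix z assume z: "z \<in> inputs n"
  have "inj (var_order B)"
    using obdd(1) permutes_inj by (auto simp: is_obdd_def)
  then have "state_after B (override_on z x V) n = state_after B (override_on z y V) n"
    unfolding V_def using \<open>j \<le> n\<close> state by (rule state_after_override_on_eq)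
  then show "f (override_on z x V) = f (override_on z y V)"
    using obdd(2) override_on_in_inputs z inputs unfolding computes_def by metis
qed

theorem card_subfunctions_le_width:
  assumes obdd: "is_obdd n B" "computes n B f" and "j \<le> n"
  shows "card (subfunctions n f (var_order B ` {1..j})) \<le> width B"
proof -
  let ?V = "var_order B ` {1..j}"
  define reaches where
    "reaches g s \<longleftrightarrow> (\<exists>x\<in>inputs n. g = subfunction n f ?V x \<and> s = state_after B x j)" for g s
  have "finite (states B)"
    using obdd(1) by (simp add: is_obdd_def)
  moreover have "\<exists>s. s \<in> states B \<and> reaches g s" if "g \<in> subfunctions n f ?V" for g
    using that state_after_in_states[OF obdd(1) \<open>j \<le> n\<close>]
    by (auto simp: subfunctions_def reaches_def)
  moreover have "g = h" if "reaches g s" "reaches h s" for g h s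
    using that subfunction_eq_if_state_after_eq[OF assms] unfolding reaches_def by metis
  ultimately show ?thesis
    unfolding width_def by (rule card_le_if_inj_on_rel)
qed

lemma ex_card_Int_prefix_image_eq:
  fixes \<pi> :: "nat \<Rightarrow> 'a"
  assumes "E \<subseteq> \<pi> ` {1..n}" "m \<le> card E"
  shows "\<exists>j\<le>n. card (E \<inter> \<pi> ` {1..j}) = m"
proof -
  let ?c = "\<lambda>j. int (card (E \<inter> \<pi> ` {1..j}))"
  have "\<exists>j\<le>n. ?c j = int m"
  proof (rule nat0_intermed_int_val)
    have "\<bar>?c (i + 1) - ?c i\<bar> \<le> 1" for i
      by (simp add: atLeastAtMostSuc_conv Int_insert_right card_insert_if)
    then show "\<forall>i<n. \<bar>?c (i + 1) - ?c i\<bar> \<le> 1" by blast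
    show "int m \<le> ?c n" using assms by (simp add: Int_absorb2)
  qed simp
  then show ?thesis by simp
qed

section \<open>Every function has an OBDD\<close>

definition recording_obdd :: "nat \<Rightarrow> ((nat \<Rightarrow> bool) \<Rightarrow> bool) \<Rightarrow> nat obdd" where
  "recording_obdd n f = \<lparr>var_order = id, states = set_encode ` Pow {1..n}, init = set_encode {},
     trans_map = (\<lambda>j b s. if b then set_encode (insert j (set_decode s)) else s),
     accepting = {s \<in> set_encode ` Pow {1..n}. f (\<lambda>i\<in>{1..n}. i \<in> set_decode s)}\<rparr>"

lemma is_obdd_recording_obdd: "is_obdd n (recording_obdd n f)"
proof -
  have "set_encode (insert j (set_decode s)) \<in> set_encode ` Pow {1..n}"
    if j_range: "j \<in> {1..n}" and s_code: "s \<in> set_encode ` Pow {1..n}" for j s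
  proof -
    obtain S where S_code: "s = set_encode S" "S \<subseteq> {1..n}"
      using s_code by blast
    then have "set_decode s = S"
      by (simp add: finite_subset)
    with j_range S_code(2) show ?thesis by simp
  qed
  moreover have "set_encode {} \<in> set_encode ` Pow {1..n}"
    by (rule imageI) simp
  ultimately show ?thesis
    by (auto simp: is_obdd_def recording_obdd_def permutes_id)
qed

lemma state_after_recording_obdd:
  "state_after (recording_obdd n f) x j = set_encode {i \<in> {1..j}. x i}"
proof (induction j)
  case 0
  then show ?case by (simp add: recording_obdd_def)
next
  case (Suc j)
  have "{i \<in> {1..Suc j}. x i} =
      (if x (Suc j) then insert (Suc j) {i \<in> {1..j}. x i} else {i \<in> {1..j}. x i})"
    by (auto simp: le_Suc_eq)
  then show ?case using Suc by (simp add: recording_obdd_def)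
qed

lemma computes_recording_obdd: "computes n (recording_obdd n f) f"
  unfolding computes_def
proof
  fix x assume "x \<in> inputs n"
  then have "(\<lambda>i\<in>{1..n}. i \<in> {i \<in> {1..n}. x i}) = x"
    by (auto simp: inputs_def PiE_def extensional_def fun_eq_iff)
  moreover have "{i \<in> {1..n}. x i} \<in> Pow {1..n}" by blast
  ultimately show "state_after (recording_obdd n f) x n \<in> accepting (recording_obdd n f) \<longleftrightarrow> f x"
    unfolding state_after_recording_obdd by (simp add: recording_obdd_def)
qed

lemma le_OBDD:
  assumes "\<And>B :: nat obdd. \<lbrakk>is_obdd n B; computes n B f\<rbrakk> \<Longrightarrow> m \<le> width B"
  shows "m \<le> OBDD n f"
  unfolding OBDD_def
  by (rule cInf_greatest)
    (use is_obdd_recording_obdd[of n f] computes_recording_obdd[of n f] assms in auto)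

section \<open>Shuffled storage access\<close>

lemma shift_all_append_eq_map2:
  assumes "length \<alpha> = length ks"
  shows "shift_all x (\<alpha> @ bs) ks = bs @ map2 (\<lambda>a k. a \<noteq> x k) \<alpha> ks"
  using assms
proof (induction \<alpha> ks arbitrary: bs rule: list_induct2)
  case Nil
  then show ?case by (simp add: shift_all_def)
next
  case (Cons a \<alpha> k ks)
  then show ?case using Cons.IH[of "bs @ [a \<noteq> x k]"] by (simp add: shift_all_def)
qed

lemma shift_all_replicate_False:
  assumes "length ks = m"
  shows "shift_all x (replicate m False) ks = map x ks"
  using shift_all_append_eq_map2[of "replicate m False" ks x "[]"] assms
  by (simp add: zip_replicate1)

lemma SSA_eq_SA_map:
  assumes "length (marked_indices n x False) = 2 ^ d" "length (marked_indices n x True) = d"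
  shows "SSA d n x = SA (map x (marked_indices n x False)) (map x (marked_indices n x True))"
  using assms by (simp add: SSA_def shift_all_replicate_False)

lemma SA_binary_address:
  assumes "i < 2 ^ d"
  shows "SA \<alpha> (rev (map (bit i) [0..<d])) = \<alpha> ! i"
  using assms by (simp add: SA_def horner_sum_bit_eq_take_bit take_bit_nat_eq_self)

lemma ex_map_eq_if_distinct:
  assumes "distinct ks" "length ks = length bs"
  shows "\<exists>f. map f ks = bs"
proof
  show "map (\<lambda>k. the (map_of (zip ks bs) k)) ks = bs"
    using assms by (auto intro!: nth_equalityI simp: map_of_zip_nth)
qed

definition even_indices :: "nat \<Rightarrow> nat set" where
  "even_indices n = {i \<in> {1..n}. even i}"

lemma even_indices_eq: "even_indices n = (*) 2 ` {1..n div 2}"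
  by (auto simp: even_indices_def image_iff elim!: evenE)

lemma finite_even_indices [simp]: "finite (even_indices n)"
  by (simp add: even_indices_def)

lemma card_even_indices: "card (even_indices n) = n div 2"
  by (simp add: even_indices_eq card_image inj_on_def)

text \<open>The odd-indexed variables route \<open>a i\<close> to the storage for \<open>i \<in> V\<close>, and to the address otherwise.\<close>

definition routed_input :: "nat \<Rightarrow> nat set \<Rightarrow> (nat \<Rightarrow> bool) \<Rightarrow> nat \<Rightarrow> bool" where
  "routed_input n V a = (\<lambda>i\<in>{1..n}. if even i then a i else Suc i \<notin> V)"

lemma routed_input_in_inputs: "routed_input n V a \<in> inputs n"
  by (auto simp: routed_input_def inputs_def)

lemma routed_input_even: "i \<in> even_indices n \<Longrightarrow> routed_input n V a i = a i"
  by (simp add: routed_input_def even_indices_def)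

lemma override_on_routed_input:
  "override_on (routed_input n V b) (routed_input n V a) U = routed_input n V (override_on b a U)"
  by (rule ext) (simp add: routed_input_def override_on_def)

lemma marked_indices_routed_input:
  "marked_indices n (routed_input n V a) b =
     sorted_list_of_set (if b then even_indices n - V else even_indices n \<inter> V)"
proof -
  have "routed_input n V a (2 * i - 1) \<longleftrightarrow> 2 * i \<notin> V" if "i \<in> {1..n div 2}" for i
    using that by (auto simp: routed_input_def)
  then have "{2 * i | i. i \<in> {1..n div 2} \<and> routed_input n V a (2 * i - 1) = b} =
      (if b then even_indices n - V else even_indices n \<inter> V)"
    unfolding even_indices_eq by auto
  then show ?thesis by (simp add: marked_indices_def)
qed

lemma SSA_routed_input:
  assumes "card (even_indices n \<inter> V) = 2 ^ d" "card (even_indices n - V) = d"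
  shows "SSA d n (routed_input n V a) =
    SA (map a (sorted_list_of_set (even_indices n \<inter> V)))
       (map a (sorted_list_of_set (even_indices n - V)))"
proof -
  have map_eq: "map (routed_input n V a) ks = map a ks" if "set ks \<subseteq> even_indices n" for ks
    using that routed_input_even by auto
  show ?thesis
    using assms by (simp add: SSA_eq_SA_map marked_indices_routed_input map_eq)
qed

lemma ex_SSA_routed_input_selects:
  assumes card: "card (even_indices n \<inter> V) = 2 ^ d" "card (even_indices n - V) = d"
    and k_storage: "k \<in> even_indices n \<inter> V"
  shows "\<exists>b. \<forall>a. SSA d n (routed_input n V (override_on b a V)) = a k"
proof -
  define storage where "storage = sorted_list_of_set (even_indices n \<inter> V)"
  define address where "address = sorted_list_of_set (even_indices n - V)"
  have storage: "set storage = even_indices n \<inter> V" "length storage = 2 ^ d"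
    and address: "set address = even_indices n - V" "length address = d" "distinct address"
    using card by (simp_all add: storage_def address_def)
  obtain i where storage_nth: "i < 2 ^ d" "storage ! i = k"
    using k_storage storage by (metis in_set_conv_nth)
  obtain b where address_bits: "map b address = rev (map (bit i) [0..<d])"
    using ex_map_eq_if_distinct[of address "rev (map (bit i) [0..<d])"] address by auto
  have "SSA d n (routed_input n V (override_on b a V)) = a k" for a
  proof -
    have "map (override_on b a V) storage = map a storage"
      using storage(1) by simp
    moreover have "map (override_on b a V) address = map b address"
      using address(1) by simp
    ultimately have "SSA d n (routed_input n V (override_on b a V)) =
        SA (map a storage) (rev (map (bit i) [0..<d]))"
      by (simp only: SSA_routed_input[OF card] address_bits flip: storage_def address_def)
    also have "\<dots> = map a storage ! i"
      by (rule SA_binary_address) (rule storage_nth(1))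
    also have "\<dots> = a k"
      using storage_nth storage(2) by simp
    finally show ?thesis .
  qed
  then show ?thesis by blast
qed

lemma card_subfunctions_SSA_ge:
  assumes card: "card (even_indices n \<inter> V) = 2 ^ d" "card (even_indices n - V) = d"
  shows "2 ^ (2 ^ d) \<le> card (subfunctions n (SSA d n) V)"
proof -
  let ?A = "even_indices n \<inter> V \<rightarrow>\<^sub>E (UNIV :: bool set)"
  let ?g = "\<lambda>a. subfunction n (SSA d n) V (routed_input n V a)"
  have "inj_on ?g ?A"
  proof (rule inj_onI)
    fix a a' assume in_A: "a \<in> ?A" "a' \<in> ?A" and g_eq: "?g a = ?g a'"
    show "a = a'"
    proof (rule PiE_ext[OF in_A])
      fix k assume "k \<in> even_indices n \<inter> V"
      then obtain b where selects: "\<And>a. SSA d n (routed_input n V (override_on b a V)) = a k"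
        using ex_SSA_routed_input_selects[OF card] by blast
      have "?g a (routed_input n V b) = a k" for a
        by (simp add: subfunction_def routed_input_in_inputs override_on_routed_input selects)
      then show "a k = a' k" using g_eq by metis
    qed
  qed
  moreover have "?g ` ?A \<subseteq> subfunctions n (SSA d n) V"
    using routed_input_in_inputs by (auto simp: subfunctions_def)
  ultimately have "card ?A \<le> card (subfunctions n (SSA d n) V)"
    using finite_subfunctions by (rule card_inj_on_le)
  then show ?thesis by (simp add: card_funcsetE card(1))
qed

lemma width_SSA_ge:
  assumes obdd: "is_obdd n B" "computes n B (SSA d n)" and half: "2 ^ d + d = n div 2"
  shows "2 ^ (2 ^ d) \<le> width B"
proof -
  have "even_indices n \<subseteq> var_order B ` {1..n}"
    using obdd(1) by (auto simp: is_obdd_def permutes_image even_indices_def)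
  moreover have "2 ^ d \<le> card (even_indices n)"
    using half by (simp add: card_even_indices)
  ultimately obtain j where "j \<le> n"
    and card_storage: "card (even_indices n \<inter> var_order B ` {1..j}) = 2 ^ d"
    using ex_card_Int_prefix_image_eq by blast
  then have "card (even_indices n - var_order B ` {1..j}) = d"
    using half by (simp add: card_Diff_subset_Int card_even_indices)
  with card_storage have "2 ^ (2 ^ d) \<le> card (subfunctions n (SSA d n) (var_order B ` {1..j}))"
    by (rule card_subfunctions_SSA_ge)
  also have "\<dots> \<le> width B"
    using obdd \<open>j \<le> n\<close> by (rule card_subfunctions_le_width)
  finally show ?thesis .
qed

theorem theorem5:
  fixes d n :: nat
  assumes "d \<ge> 1" and "even n" and "2 ^ d + d = n div 2"
  shows "(\<forall>B :: 's obdd. is_obdd n B \<and> computes n B (SSA d n) \<longrightarrow> width B \<ge> 2 ^ (2 ^ d)) \<and>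
         OBDD n (SSA d n) \<ge> 2 ^ (2 ^ d)"
proof
  show "\<forall>B :: 's obdd. is_obdd n B \<and> computes n B (SSA d n) \<longrightarrow> width B \<ge> 2 ^ (2 ^ d)"
    using width_SSA_ge[OF _ _ assms(3)] by blast
  show "OBDD n (SSA d n) \<ge> 2 ^ (2 ^ d)"
    by (rule le_OBDD) (rule width_SSA_ge[OF _ _ assms(3)])
qed

end
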